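(* Let $C \subseteq \mathbb{R}^n$ be nonempty, closed, convex and line-free and let $P$ be an $(\varepsilon,\delta)$-approximation of $C$. Then for every $x \in \operatorname{conv} \operatorname{vert} P$ and every $r \geq \varepsilon$ there exists $v \in \operatorname{conv}\operatorname{vert} P$ such that $$d_{\mathsf H}\left(P \cap B_r(x),\, C \cap B_r(x)\right) \leq 2\left(\varepsilon+\delta\left(r+\|x-v\|\right)\right).$$ In particular, if the Hausdorff distance $d_{\mathsf H}(P \cap B_r(x), C \cap B_r(x))$ is attained as $\|p-c\|$ with $p \in P\cap B_r(x)$ and $c \in C \cap B_r(x)$ (that is, $c$ is a nearest point to $p$ in $C\cap B_r(x)$ and $\|p-c\| = d_{\mathsf H}(P \cap B_r(x), C \cap B_r(x))$), then $v$ can be taken such that $p = v + td$ for some $d \in 0^+P$ and $t \geq 0$.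
   Context: $\|\cdot\|$ is the Euclidean norm, $B_r(c)$ is the closed Euclidean ball of radius $r$ centered at $c$, and $0^+C$ is the recession cone of $C$. A closed convex set is line-free if its recession cone $K$ is pointed, i.e. $K \cap (-K) = \{0\}$. A polyhedron is a set $\operatorname{conv} V + \operatorname{cone} D$ with $V, D$ finite; $\operatorname{vert} P$ denotes its set of vertices (extreme points). For nonempty $C_1,C_2\subseteq\mathbb{R}^n$ the excess of $C_1$ over $C_2$ is $e[C_1,C_2] = \sup_{c_1 \in C_1} \inf_{c_2 \in C_2} \|c_1-c_2\|$, and the Hausdorff distance is $d_{\mathsf H}(C_1,C_2) = \max\{e[C_1,C_2], e[C_2,C_1]\}$. For nonempty closed convex cones $K_1,K_2$ the truncated Hausdorff distance is $\bar d_{\mathsf H}(K_1,K_2) = d_{\mathsf H}(K_1\cap B_1(0), K_2 \cap B_1(0))$. Given a nonempty closed convex line-free set $C\subseteq\mathbb{R}^n$ and $\varepsilon,\delta\ge 0$, a line-free polyhedron $P$ is called an $(\varepsilon,\delta)$-approximation of $C$ if (i) $e[\operatorname{vert} P, C] \leq \varepsilon$, (ii) $\bar d_{\mathsf H}(0^+P, 0^+C) \leq \delta$, and (iii) $P \supseteq C$. *)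

theory Defs
  imports "HOL-Analysis.Analysis"
begin

definition recession_cone :: "'a::real_vector set \<Rightarrow> 'a set"
  where "recession_cone C = {d. \<forall>x\<in>C. \<forall>t\<ge>0. x + t *\<^sub>R d \<in> C}"

(* Meant for closed convex C only; finitely generated polyhedra are always closed and convex. *)
definition line_free :: "'a::real_vector set \<Rightarrow> bool"
  where "line_free C \<longleftrightarrow> recession_cone C \<inter> uminus ` recession_cone C = {0}"

(* The library's polyhedron is the half-space notion; here a polyhedron is
   conv V + cone D. Since convex_cone hull {} = {0}, polytopes are included. *)
definition fg_polyhedron :: "'a::real_vector set \<Rightarrow> bool"
  where "fg_polyhedron P \<longleftrightarrow>
    (\<exists>V D. finite V \<and> finite D \<and> P = {v + d |v d. v \<in> convex hull V \<and> d \<in> convex_cone hull D})"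

definition verts :: "'a::real_vector set \<Rightarrow> 'a set"
  where "verts P = {x. x extreme_point_of P}"

(* Extended real values: the excess may be infinite, and the infimum over the
   empty set is \<infinity>, so a finite bound on the excess of a nonempty set over B
   forces B to be nonempty. *)
definition excess :: "'a::real_normed_vector set \<Rightarrow> 'a set \<Rightarrow> ereal"
  where "excess A B = (SUP a\<in>A. INF b\<in>B. ereal (norm (a - b)))"

definition hausdorff_distance :: "'a::real_normed_vector set \<Rightarrow> 'a set \<Rightarrow> ereal"
  where "hausdorff_distance A B = max (excess A B) (excess B A)"

definition truncated_hausdorff_distance :: "'a::real_normed_vector set \<Rightarrow> 'a set \<Rightarrow> ereal"
  where "truncated_hausdorff_distance K L = hausdorff_distance (K \<inter> cball 0 1) (L \<inter> cball 0 1)"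

definition eps_delta_approximation ::
    "real \<Rightarrow> real \<Rightarrow> 'a::real_normed_vector set \<Rightarrow> 'a set \<Rightarrow> bool"
  where "eps_delta_approximation \<epsilon> \<delta> C P \<longleftrightarrow>
    fg_polyhedron P \<and> line_free P \<and>
    excess (verts P) C \<le> ereal \<epsilon> \<and>
    truncated_hausdorff_distance (recession_cone P) (recession_cone C) \<le> ereal \<delta> \<and>
    C \<subseteq> P"

end

theory Submission
  imports Defs
begin

text \<open>
  Among generating sets of a line-free polyhedron \<open>P = conv V + K\<close>, take an irredundant one:
  its points are vertices, for if a generator \<open>v\<close> were inside a segment of \<open>P\<close>, then either
  \<open>v\<close> would be generated by the others or \<open>K\<close> would contain a line. Hence every \<open>p \<in> P\<close> is
  \<open>v + d\<close> with \<open>v \<in> conv vert P\<close> and \<open>d\<close> a recession direction. Moving \<open>v\<close> into \<open>C\<close> and \<open>d\<close> into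
  the recession cone of \<open>C\<close> gives a point \<open>c\<close> of \<open>C\<close> with \<open>\<parallel>p - c\<parallel> \<le> \<eta> = \<epsilon> + \<delta> (r + \<parallel>x - v\<parallel>)\<close>. If \<open>c\<close>
  leaves the ball around \<open>x\<close>, pull it towards a point of \<open>C\<close> within \<open>\<epsilon>\<close> of \<open>x\<close>; this at
  most doubles the error. A point \<open>v\<close> of \<open>conv vert P\<close> farthest from \<open>x\<close> serves all \<open>p\<close> at once.
\<close>

section \<open>Recession cones and sums with a convex cone\<close>

lemma recession_cone_scaleR:
  assumes "d \<in> recession_cone C" "0 \<le> s"
  shows "s *\<^sub>R d \<in> recession_cone C"
  unfolding recession_cone_def
proof (clarify)
  fix x and t :: real
  assume "x \<in> C" "0 \<le> t"
  then have "x + (t * s) *\<^sub>R d \<in> C"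
    using assms unfolding recession_cone_def by (metis (no_types, lifting) mem_Collect_eq mult_nonneg_nonneg)
  then show "x + t *\<^sub>R s *\<^sub>R d \<in> C"
    by simp
qed

lemma closed_recession_cone:
  fixes C :: "'a::real_normed_vector set"
  assumes "closed C"
  shows "closed (recession_cone C)"
proof -
  have "recession_cone C = (\<Inter>x\<in>C. \<Inter>t\<in>{0..}. (\<lambda>d. x + t *\<^sub>R d) -` C)"
    by (auto simp: recession_cone_def)
  moreover have "closed ((\<lambda>d. x + t *\<^sub>R d) -` C)" for x and t :: real
    by (intro closed_vimage assms continuous_intros)
  ultimately show ?thesis
    by (metis (no_types, lifting) closed_INT)
qed

lemma convex_cone_subset_recession_cone_plus:
  assumes "convex_cone K"
  shows "K \<subseteq> recession_cone (S + K)"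
proof (clarsimp simp: recession_cone_def)
  fix d y and t :: real
  assume d: "d \<in> K" and y: "y \<in> S + K" and t: "0 \<le> t"
  obtain s k where "y = s + k" "s \<in> S" "k \<in> K"
    using y by (auto elim: set_plus_elim)
  then have "y + t *\<^sub>R d = s + (k + t *\<^sub>R d)" "k + t *\<^sub>R d \<in> K"
    using assms d t by (auto simp: convex_cone_add convex_cone_scaleR)
  then show "y + t *\<^sub>R d \<in> S + K"
    using \<open>s \<in> S\<close> by (metis set_plus_intro)
qed

lemma convex_cone_plus_absorb:
  assumes "convex_cone K" "a \<in> S + K" "k \<in> K"
  shows "a + k \<in> S + K"
  using convex_cone_subset_recession_cone_plus[OF assms(1), of S] assms(2,3)
  unfolding recession_cone_def by (force dest: spec[of _ 1])

lemma plus_convex_hull_mono_of_mem: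
  assumes K: "convex_cone K" and v: "v \<in> convex hull W + K"
  shows "convex hull (insert v W) + K = convex hull W + K"
proof (rule subset_antisym)
  have "W \<subseteq> convex hull W + K"
    using convex_cone_contains_0[OF K] hull_subset[of W convex]
    by (metis add.right_neutral set_plus_intro subset_iff)
  moreover have "convex (convex hull W + K)"
    using K by (simp add: convex_set_plus convex_cone_def)
  ultimately have "convex hull (insert v W) \<subseteq> convex hull W + K"
    using v by (intro hull_minimal) auto
  then show "convex hull (insert v W) + K \<subseteq> convex hull W + K"
    by (auto elim!: set_plus_elim intro: convex_cone_plus_absorb[OF K])
  show "convex hull W + K \<subseteq> convex hull (insert v W) + K"
    by (intro set_plus_mono2 hull_mono) auto
qed

section \<open>Irredundant generators and vertices\<close>

lemma irredundant_generators_exist: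
  assumes "finite V" and K: "convex_cone K"
  shows "\<exists>W\<subseteq>V. convex hull W + K = convex hull V + K \<and> (\<forall>v\<in>W. v \<notin> convex hull (W - {v}) + K)"
  using assms(1)
proof (induction V rule: finite_psubset_induct)
  case (psubset V)
  show ?case
  proof (cases "\<forall>v\<in>V. v \<notin> convex hull (V - {v}) + K")
    case False
    then obtain v where v: "v \<in> V" "v \<in> convex hull (V - {v}) + K"
      by blast
    \<comment> \<open>Dropping a generator produced by the others keeps the sum and shrinks the
      finite set, so the descent ends in an irredundant one.\<close>
    then have "convex hull (V - {v}) + K = convex hull V + K"
      using plus_convex_hull_mono_of_mem[OF K v(2)] by (simp add: insert_absorb)
    then show ?thesis
      using psubset.IH[of "V - {v}"] v(1) by blast
  qed blast
qed

text \<open>If \<open>v\<close> were in an open segment, the directions from \<open>v\<close> to its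
  endpoints would have a vanishing positive combination. Each direction lies in \<open>K\<close> or
  is a positive multiple of \<open>q - v\<close> with \<open>q\<close> in
  \<open>convex hull W + K\<close>. Two in \<open>K\<close> contradict pointedness; any other pair
  puts \<open>v\<close> into \<open>convex hull W + K\<close>.\<close>

lemma irredundant_generator_extreme:
  assumes K: "convex_cone K" and pointed: "\<And>k. k \<in> K \<Longrightarrow> - k \<in> K \<Longrightarrow> k = 0"
    and v: "v \<notin> convex hull W + K"
  shows "v extreme_point_of (convex hull (insert v W) + K)"
proof -
  define Q where "Q = convex hull W + K"
  have convQ: "convex Q"
    using K by (simp add: Q_def convex_set_plus convex_cone_def)
  have rep: "(\<exists>k\<in>K. a - v = k) \<or> (\<exists>\<beta>>0. \<exists>q\<in>Q. a - v = \<beta> *\<^sub>R (q - v))"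
    if a: "a \<in> convex hull (insert v W) + K" for a
  proof -
    obtain b k where a_eq: "a = b + k" and b: "b \<in> convex hull (insert v W)" and k: "k \<in> K"
      using a by (auto elim: set_plus_elim)
    show ?thesis
    proof (cases "b = v")
      case True
      then show ?thesis
        using a_eq k by auto
    next
      case False
      then obtain u w where b_eq: "b = (1 - u) *\<^sub>R v + u *\<^sub>R w" and "0 \<le> u" and w: "w \<in> convex hull W"
        using b by (auto simp: convex_hull_insert_alt split: if_splits)
      with False have u: "0 < u"
        by (cases "u = 0") auto
      \<comment> \<open>Rescaling \<open>k\<close> by \<open>1 / u\<close> absorbs it into the point
        of \<open>Q\<close> at which the direction aims.\<close>
      have "a - v = u *\<^sub>R ((w + (1 / u) *\<^sub>R k) - v)"
        using u by (simp add: a_eq b_eq algebra_simps)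
      moreover have "w + (1 / u) *\<^sub>R k \<in> Q"
        unfolding Q_def using w k u K by (intro set_plus_intro) (auto simp: convex_cone_scaleR)
      ultimately show ?thesis
        using u by blast
    qed
  qed
  have ray: False
    if "k \<in> K" "q \<in> Q" "0 < s" "k + s *\<^sub>R (q - v) = 0" for k q s
  proof -
    have "s *\<^sub>R v = s *\<^sub>R q + k"
      using that(4) by (simp add: algebra_simps)
    then have "(1 / s) *\<^sub>R (s *\<^sub>R v) = (1 / s) *\<^sub>R (s *\<^sub>R q + k)"
      by simp
    then have "v = q + (1 / s) *\<^sub>R k"
      using that(3) by (simp add: scaleR_add_right)
    moreover have "(1 / s) *\<^sub>R k \<in> K"
      using that K by (simp add: convex_cone_scaleR)
    ultimately show False
      using convex_cone_plus_absorb[OF K, of q "convex hull W" "(1 / s) *\<^sub>R k"] that(2) v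
      unfolding Q_def by auto
  qed
  have chord: False
    if "q \<in> Q" "q' \<in> Q" "0 < s" "0 < s'" "s *\<^sub>R (q - v) + s' *\<^sub>R (q' - v) = 0" for q q' s s'
  proof -
    have "(s + s') *\<^sub>R v = s *\<^sub>R q + s' *\<^sub>R q'"
      using that(5) by (simp add: algebra_simps)
    then have "(1 / (s + s')) *\<^sub>R ((s + s') *\<^sub>R v) = (1 / (s + s')) *\<^sub>R (s *\<^sub>R q + s' *\<^sub>R q')"
      by simp
    then have "v = (s / (s + s')) *\<^sub>R q + (s' / (s + s')) *\<^sub>R q'"
      using that(3,4) by (simp add: scaleR_add_right)
    moreover have "(s / (s + s')) *\<^sub>R q + (s' / (s + s')) *\<^sub>R q' \<in> Q"
      using that(3,4) by (intro convexD[OF convQ that(1,2)]) (auto simp: add_divide_distrib[symmetric])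
    ultimately show False
      using v unfolding Q_def by simp
  qed
  have "v \<notin> open_segment a b"
    if a: "a \<in> convex hull (insert v W) + K" and b: "b \<in> convex hull (insert v W) + K" for a b
  proof
    assume "v \<in> open_segment a b"
    then obtain u where ab: "a \<noteq> b" and u: "0 < u" "u < 1" and v_eq: "v = (1 - u) *\<^sub>R a + u *\<^sub>R b"
      by (auto simp: in_segment)
    have sum0: "(1 - u) *\<^sub>R (a - v) + u *\<^sub>R (b - v) = 0"
      by (subst (1 2) v_eq) (simp add: algebra_simps)
    show False
      using rep[OF a] rep[OF b]
    proof (elim disjE bexE exE conjE)
      fix k k'
      assume k: "k \<in> K" "a - v = k" "k' \<in> K" "b - v = k'"
      have "- ((1 - u) *\<^sub>R k) = u *\<^sub>R k'"
        using sum0 k by (simp add: eq_neg_iff_add_eq_0 neg_eq_iff_add_eq_0)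
      then have "(1 - u) *\<^sub>R k = 0"
        using k u K by (intro pointed) (auto simp: convex_cone_scaleR)
      with sum0 k u have "a - v = 0" "b - v = 0"
        by auto
      with ab show False
        by simp
    next
      fix k \<beta> q
      assume "k \<in> K" "a - v = k" "0 < \<beta>" "q \<in> Q" "b - v = \<beta> *\<^sub>R (q - v)"
      then show False
        using sum0 u K ray[of "(1 - u) *\<^sub>R k" q "u * \<beta>"] by (auto simp: convex_cone_scaleR)
    next
      fix k \<beta> q
      assume "k \<in> K" "b - v = k" "0 < \<beta>" "q \<in> Q" "a - v = \<beta> *\<^sub>R (q - v)"
      then show False
        using sum0 u K ray[of "u *\<^sub>R k" q "(1 - u) * \<beta>"] by (auto simp: convex_cone_scaleR add.commute)
    next
      fix \<beta> q \<beta>' q'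
      assume "0 < \<beta>" "q \<in> Q" "a - v = \<beta> *\<^sub>R (q - v)" "0 < \<beta>'" "q' \<in> Q" "b - v = \<beta>' *\<^sub>R (q' - v)"
      then show False
        using sum0 u chord[of q q' "(1 - u) * \<beta>" "u * \<beta>'"] by auto
    qed
  qed
  moreover have "v \<in> convex hull (insert v W) + K"
    using convex_cone_contains_0[OF K] hull_inc[of v "insert v W" convex]
    by (metis add.right_neutral insertI1 set_plus_intro)
  ultimately show ?thesis
    by (simp add: extreme_point_of_def)
qed

text \<open>A nonzero cone part \<open>k\<close> makes \<open>b + k\<close> the midpoint of
  \<open>b\<close> and \<open>b + 2 *\<^sub>R k\<close>, so an extreme point has none and is extreme
  in \<open>convex hull V\<close> itself. Finiteness of the vertex set follows.\<close>

lemma extreme_point_of_convex_hull_plus_cone: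
  assumes K: "convex_cone K" and x: "x extreme_point_of (convex hull V + K)"
  shows "x \<in> V"
proof -
  obtain b k where x_eq: "x = b + k" and b: "b \<in> convex hull V" and k: "k \<in> K"
    using x by (auto simp: extreme_point_of_def elim: set_plus_elim)
  have K0: "0 \<in> K"
    using K by (rule convex_cone_contains_0)
  have sub: "convex hull V \<subseteq> convex hull V + K"
    using K0 by (metis add.right_neutral set_plus_intro subsetI)
  have "k = 0"
  proof (rule ccontr)
    assume "k \<noteq> 0"
    then have "x \<in> open_segment b (b + 2 *\<^sub>R k)"
      unfolding in_segment by (auto simp: x_eq algebra_simps intro!: exI[of _ "1/2"])
    moreover have "b \<in> convex hull V + K" "b + 2 *\<^sub>R k \<in> convex hull V + K"
      using b k K sub by (auto simp: convex_cone_scaleR intro: set_plus_intro)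
    ultimately show False
      using x by (auto simp: extreme_point_of_def)
  qed
  then have "x extreme_point_of (convex hull V)"
    using x b sub x_eq by (auto simp: extreme_point_of_def)
  then show ?thesis
    by (rule extreme_point_of_convex_hull)
qed

lemma fg_polyhedronE:
  assumes "fg_polyhedron P"
  obtains V K where "finite V" "convex_cone K" "P = convex hull V + K"
proof -
  obtain V D where V: "finite V" and P: "P = {v + d |v d. v \<in> convex hull V \<and> d \<in> convex_cone hull D}"
    using assms by (auto simp: fg_polyhedron_def)
  show ?thesis
    by (rule that[of V "convex_cone hull D"])
      (use V P in \<open>auto simp: convex_cone_convex_cone_hull set_plus_def\<close>)
qed

lemma finite_verts:
  assumes "fg_polyhedron P"
  shows "finite (verts P)"
proof -
  obtain V K where "finite V" "convex_cone K" "P = convex hull V + K"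
    using assms by (rule fg_polyhedronE)
  then show ?thesis
    using extreme_point_of_convex_hull_plus_cone
    by (intro finite_subset[of "verts P" V]) (auto simp: verts_def)
qed

text \<open>Since \<open>K\<close> lies in the recession cone of \<open>P\<close>, line-freeness
  makes \<open>K\<close> pointed, and irredundant generators are then vertices.\<close>

lemma line_free_polyhedron_decomposition:
  assumes "fg_polyhedron P" "line_free P" "p \<in> P"
  obtains v d where "v \<in> convex hull (verts P)" "d \<in> recession_cone P" "p = v + d"
proof -
  obtain V K where V: "finite V" and K: "convex_cone K" and P: "P = convex hull V + K"
    using assms(1) by (rule fg_polyhedronE)
  have Krec: "K \<subseteq> recession_cone P"
    unfolding P by (rule convex_cone_subset_recession_cone_plus[OF K])
  have pointed: "k = 0" if "k \<in> K" "- k \<in> K" for k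
  proof -
    have "k \<in> recession_cone P \<inter> uminus ` recession_cone P"
      using that Krec by (auto intro: image_eqI[of _ _ "- k"])
    then have "k \<in> {0}"
      using assms(2) by (simp only: line_free_def)
    then show ?thesis
      by simp
  qed
  obtain W where W: "convex hull W + K = P" and irr: "\<forall>v\<in>W. v \<notin> convex hull (W - {v}) + K"
    using irredundant_generators_exist[OF V K] P by blast
  have "W \<subseteq> verts P"
    using irredundant_generator_extreme[OF K pointed] irr W
    by (auto simp: verts_def) (metis insert_Diff)
  then have "convex hull W \<subseteq> convex hull (verts P)"
    by (rule hull_mono)
  moreover obtain v d where "p = v + d" "v \<in> convex hull W" "d \<in> K"
    using assms(3) W by (auto elim: set_plus_elim)
  ultimately show ?thesis
    using that Krec by blast
qed

section \<open>Excess bounds and nearby points\<close>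

lemma excess_attained:
  fixes A B :: "'a::euclidean_space set"
  assumes "closed B" "excess A B \<le> ereal e" "a \<in> A"
  obtains b where "b \<in> B" "norm (a - b) \<le> e"
proof -
  have le: "(INF b\<in>B. ereal (norm (a - b))) \<le> ereal e"
    using assms(2,3) unfolding excess_def by (meson SUP_upper order_trans)
  \<comment> \<open>Over an empty \<open>B\<close> the infimum would be \<open>\<infinity>\<close>,
    above every real \<open>e\<close>.\<close>
  then have "B \<noteq> {}"
    by (auto simp: top_ereal_def)
  then obtain b where b: "b \<in> B" "\<And>y. y \<in> B \<Longrightarrow> dist a b \<le> dist a y"
    using distance_attains_inf[OF assms(1)] by metis
  then have "ereal (norm (a - b)) \<le> (INF b\<in>B. ereal (norm (a - b)))"
    by (intro INF_greatest) (simp add: dist_norm)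
  then have "norm (a - b) \<le> e"
    using le by (metis ereal_less_eq(3) order_trans)
  then show ?thesis
    using that b(1) by blast
qed

lemma excess_le:
  assumes "\<And>a. a \<in> A \<Longrightarrow> \<exists>b\<in>B. norm (a - b) \<le> e"
  shows "excess A B \<le> ereal e"
  unfolding excess_def
proof (rule SUP_least)
  fix a assume "a \<in> A"
  then obtain b where "b \<in> B" "norm (a - b) \<le> e"
    using assms by blast
  then show "(INF b\<in>B. ereal (norm (a - b))) \<le> ereal e"
    by (intro INF_lower2[of b]) auto
qed

text \<open>The neighbourhood \<open>C + cball 0 e\<close> is convex, so it contains the hull of
  \<open>A\<close> once it contains \<open>A\<close>.\<close>

lemma convex_hull_near_convex:
  fixes C :: "'a::euclidean_space set"
  assumes "closed C" "convex C" "excess A C \<le> ereal e" "x \<in> convex hull A"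
  obtains y where "y \<in> C" "norm (x - y) \<le> e"
proof -
  have "convex hull A \<subseteq> C + cball 0 e"
  proof (rule hull_minimal)
    show "A \<subseteq> C + cball 0 e"
    proof
      fix a assume "a \<in> A"
      then obtain c where "c \<in> C" "norm (a - c) \<le> e"
        using excess_attained[OF assms(1,3)] by blast
      then show "a \<in> C + cball 0 e"
        using set_plus_intro[of c C "a - c" "cball 0 e"] by simp
    qed
    show "convex (C + cball 0 e)"
      using assms(2) by (simp add: convex_set_plus)
  qed
  then obtain y z where "x = y + z" "y \<in> C" "z \<in> cball 0 e"
    using assms(4) by (meson set_plus_elim subsetD)
  then show ?thesis
    using that[of y] by simp
qed

text \<open>The truncated distance compares directions in the unit ball only. Normalising
  \<open>d\<close> and scaling the nearby direction back by \<open>norm d\<close> makes the error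
  proportional to \<open>norm d\<close>.\<close>

lemma recession_direction_near:
  fixes C P :: "'a::euclidean_space set"
  assumes "closed C" "d \<in> recession_cone P"
    and \<delta>: "truncated_hausdorff_distance (recession_cone P) (recession_cone C) \<le> ereal \<delta>"
  obtains d' where "d' \<in> recession_cone C" "norm (d - d') \<le> \<delta> * norm d"
proof (cases "d = 0")
  case True
  then show ?thesis
    using that[of 0] by (simp add: recession_cone_def)
next
  case False
  define e where "e = (1 / norm d) *\<^sub>R d"
  have "e \<in> recession_cone P \<inter> cball 0 1"
    using False assms(2) by (simp add: e_def recession_cone_scaleR)
  moreover have "excess (recession_cone P \<inter> cball 0 1) (recession_cone C \<inter> cball 0 1) \<le> ereal \<delta>"
    using \<delta> by (simp add: truncated_hausdorff_distance_def hausdorff_distance_def)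
  moreover have "closed (recession_cone C \<inter> cball 0 1)"
    by (simp add: closed_Int closed_recession_cone assms(1))
  ultimately obtain e' where e': "e' \<in> recession_cone C" "norm (e - e') \<le> \<delta>"
    using excess_attained by blast
  have "d - norm d *\<^sub>R e' = norm d *\<^sub>R (e - e')"
    using False by (simp add: e_def scaleR_diff_right)
  then have "norm (d - norm d *\<^sub>R e') \<le> \<delta> * norm d"
    using mult_left_mono[OF e'(2) norm_ge_zero[of d]] by (simp add: mult.commute)
  then show ?thesis
    using that[of "norm d *\<^sub>R e'"] e'(1) by (simp add: recession_cone_scaleR)
qed

text \<open>The point \<open>y\<close> has slack at least \<open>r - \<epsilon>\<close> in the ball
  around \<open>x\<close>, and \<open>c\<close> overshoots by at most \<open>\<eta>\<close>, so a
  suitable convex combination of the two stays inside.\<close>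

lemma near_point_in_cball:
  fixes C :: "'a::real_normed_vector set"
  assumes "convex C" "y \<in> C" "c \<in> C"
    and y: "norm (x - y) \<le> \<epsilon>" and c: "norm (p - c) \<le> \<eta>" and p: "norm (x - p) \<le> r"
    and le: "\<epsilon> \<le> \<eta>" "\<epsilon> \<le> r"
  obtains z where "z \<in> C" "norm (x - z) \<le> r" "norm (p - z) \<le> 2 * \<eta>"
proof (cases "r + \<eta> - \<epsilon> = 0")
  case True
  \<comment> \<open>Both \<open>r - \<epsilon>\<close> and \<open>\<eta>\<close> are nonnegative, so
    this case forces \<open>r = \<epsilon> = \<eta> = 0\<close> and \<open>p = x = y\<close>; the
    weights used below would divide by zero.\<close>
  have "norm (p - y) \<le> norm (x - p) + norm (x - y)"
    using norm_triangle_ineq4[of "x - y" "x - p"] by simp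
  then show ?thesis
    using that[of y] True assms norm_ge_zero[of "p - c"] norm_ge_zero[of "x - y"] by linarith
next
  case False
  define s where "s = r + \<eta> - \<epsilon>"
  have nonneg: "0 \<le> \<epsilon>" "0 \<le> \<eta>"
    using y c norm_ge_zero order_trans by blast+
  then have s: "0 < s"
    using False le by (simp add: s_def)
  \<comment> \<open>The weights for which the crude bound \<open>a * (r + \<eta>) + b * \<epsilon>\<close> on the distance to \<open>x\<close> is exactly \<open>r\<close>.\<close>
  define a b where "a = (r - \<epsilon>) / s" and "b = \<eta> / s"
  have ab: "0 \<le> a" "0 \<le> b" "a + b = 1"
    using s le nonneg by (auto simp: a_def b_def add_divide_distrib[symmetric] s_def)
  define z where "z = a *\<^sub>R c + b *\<^sub>R y"
  have diff: "w - z = a *\<^sub>R (w - c) + b *\<^sub>R (w - y)" for w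
  proof -
    have "w = a *\<^sub>R w + b *\<^sub>R w"
      using ab(3) by (metis scaleR_add_left scaleR_one)
    then show ?thesis
      by (simp add: z_def algebra_simps)
  qed
  have dist: "norm (w - z) \<le> a * norm (w - c) + b * norm (w - y)" for w
    unfolding diff using ab norm_triangle_ineq[of "a *\<^sub>R (w - c)" "b *\<^sub>R (w - y)"] by simp
  have "norm (x - c) \<le> r + \<eta>"
    using norm_triangle_mono[OF p c] by simp
  then have "norm (x - z) \<le> a * (r + \<eta>) + b * \<epsilon>"
    using dist[of x] ab y by (smt (verit) mult_left_mono)
  also have "\<dots> = r"
    using s by (simp add: a_def b_def field_simps) (simp add: s_def algebra_simps)
  finally have xz: "norm (x - z) \<le> r" .
  have "norm (p - y) \<le> r + \<epsilon>"
    using norm_triangle_mono[of "p - x" r "x - y" \<epsilon>] p y by (simp add: norm_minus_commute)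
  then have "norm (p - z) \<le> a * \<eta> + b * (r + \<epsilon>)"
    using dist[of p] ab c by (smt (verit) mult_left_mono)
  also have "\<dots> = (2 * r * \<eta>) / s"
    using s by (simp add: a_def b_def field_simps)
  \<comment> \<open>The hypothesis \<open>\<epsilon> \<le> \<eta>\<close> gives
    \<open>r \<le> s\<close>.\<close>
  also have "\<dots> \<le> 2 * \<eta>"
    using s le nonneg mult_right_mono[of "2 * r" "2 * s" \<eta>] by (simp add: pos_divide_le_eq s_def mult.commute mult.left_commute)
  finally have "norm (p - z) \<le> 2 * \<eta>" .
  moreover have "z \<in> C"
    unfolding z_def by (rule convexD[OF assms(1,3,2) ab])
  ultimately show ?thesis
    using that xz by blast
qed

section \<open>The Hausdorff bound inside the ball\<close>

theorem proposition4p6: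
  fixes C P :: "(real ^ 'n) set" and \<epsilon> \<delta> r :: real and x :: "real ^ 'n"
  assumes "C \<noteq> {}" and "closed C" and "convex C" and "line_free C"
    and "0 \<le> \<epsilon>" and "0 \<le> \<delta>"
    and "eps_delta_approximation \<epsilon> \<delta> C P"
    and "x \<in> convex hull (verts P)" and "\<epsilon> \<le> r"
  shows "(\<exists>v \<in> convex hull (verts P).
            hausdorff_distance (P \<inter> cball x r) (C \<inter> cball x r)
              \<le> ereal (2 * (\<epsilon> + \<delta> * (r + norm (x - v))))) \<and>
         (\<forall>p \<in> P \<inter> cball x r. \<forall>c \<in> C \<inter> cball x r.
            (\<forall>c' \<in> C \<inter> cball x r. norm (p - c) \<le> norm (p - c')) \<and>
            ereal (norm (p - c)) = hausdorff_distance (P \<inter> cball x r) (C \<inter> cball x r)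
            \<longrightarrow> (\<exists>v \<in> convex hull (verts P).
                   hausdorff_distance (P \<inter> cball x r) (C \<inter> cball x r)
                     \<le> ereal (2 * (\<epsilon> + \<delta> * (r + norm (x - v)))) \<and>
                   (\<exists>d \<in> recession_cone P. \<exists>t \<ge> 0. p = v + t *\<^sub>R d)))"
proof -
  note C = \<open>closed C\<close> \<open>convex C\<close>
  have P: "fg_polyhedron P" "line_free P" "excess (verts P) C \<le> ereal \<epsilon>"
    "truncated_hausdorff_distance (recession_cone P) (recession_cone C) \<le> ereal \<delta>" "C \<subseteq> P"
    using \<open>eps_delta_approximation \<epsilon> \<delta> C P\<close> by (auto simp: eps_delta_approximation_def)
  let ?X = "convex hull (verts P)" and ?bound = "\<lambda>v. 2 * (\<epsilon> + \<delta> * (r + norm (x - v)))"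
  obtain y where y: "y \<in> C" "norm (x - y) \<le> \<epsilon>"
    using convex_hull_near_convex[OF C P(3) \<open>x \<in> ?X\<close>] .
  \<comment> \<open>The bound uses the hull part \<open>v\<close> of \<open>p\<close> itself: the
    attained case needs that very \<open>v\<close>, and the general case enlarges it to a uniform
    bound.\<close>
  have point: "\<exists>z \<in> C \<inter> cball x r. norm (p - z) \<le> ?bound v"
    if p: "p \<in> cball x r" "p = v + d" and v: "v \<in> ?X" and d: "d \<in> recession_cone P" for p v d
  proof -
    obtain c where c: "c \<in> C" "norm (v - c) \<le> \<epsilon>"
      using convex_hull_near_convex[OF C P(3) v] .
    obtain d' where d': "d' \<in> recession_cone C" "norm (d - d') \<le> \<delta> * norm d"
      using recession_direction_near[OF C(1) d P(4)] .
    have "c + d' \<in> C"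
      using c(1) d'(1) by (force simp: recession_cone_def dest: spec[of _ 1])
    \<comment> \<open>Here \<open>d\<close> equals \<open>(x - v) - (x - p)\<close>, and
      \<open>x - p\<close> has norm at most \<open>r\<close>.\<close>
    moreover have "norm d \<le> r + norm (x - v)"
      using p norm_triangle_ineq4[of "x - v" "x - p"] by (simp add: dist_norm)
    then have "\<delta> * norm d \<le> \<delta> * (r + norm (x - v))"
      using \<open>0 \<le> \<delta>\<close> by (rule mult_left_mono)
    then have "norm (p - (c + d')) \<le> \<epsilon> + \<delta> * (r + norm (x - v))"
      using norm_triangle_mono[OF c(2) d'(2)] p(2) by (simp add: algebra_simps)
    moreover have "norm (x - p) \<le> r"
      using p(1) by (simp add: dist_norm)
    \<comment> \<open>This supplies \<open>\<epsilon> \<le> \<eta>\<close> for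
      \<open>near_point_in_cball\<close>.\<close>
    moreover have "0 \<le> \<delta> * (r + norm (x - v))"
      using \<open>0 \<le> \<delta>\<close> \<open>0 \<le> \<epsilon>\<close> \<open>\<epsilon> \<le> r\<close> by simp
    ultimately obtain z where "z \<in> C" "norm (x - z) \<le> r" "norm (p - z) \<le> ?bound v"
      using near_point_in_cball[OF C(2) y(1) _ y(2), of "c + d'" p "\<epsilon> + \<delta> * (r + norm (x - v))" r]
        \<open>\<epsilon> \<le> r\<close> by (metis le_add_same_cancel1)
    then show ?thesis
      by (auto simp: dist_norm)
  qed
  \<comment> \<open>The hull of finitely many vertices is compact, so a farthest point from
    \<open>x\<close> exists; \<open>?bound\<close> grows with the distance to
    \<open>x\<close>.\<close>
  have "compact ?X" "?X \<noteq> {}"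
    using finite_verts[OF P(1)] \<open>x \<in> ?X\<close> by (auto simp: compact_convex_hull finite_imp_compact)
  then obtain v where v: "v \<in> ?X" "\<And>w. w \<in> ?X \<Longrightarrow> dist x w \<le> dist x v"
    using distance_attains_sup by metis
  have "hausdorff_distance (P \<inter> cball x r) (C \<inter> cball x r) \<le> ereal (?bound v)"
    unfolding hausdorff_distance_def
  proof (rule max.boundedI)
    show "excess (P \<inter> cball x r) (C \<inter> cball x r) \<le> ereal (?bound v)"
    proof (rule excess_le)
      fix p assume p: "p \<in> P \<inter> cball x r"
      then obtain w d where w: "w \<in> ?X" "d \<in> recession_cone P" "p = w + d"
        using line_free_polyhedron_decomposition[OF P(1,2)] by blast
      then obtain z where z: "z \<in> C \<inter> cball x r" "norm (p - z) \<le> ?bound w"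
        using point p by blast
      moreover have "?bound w \<le> ?bound v"
        using v(2)[OF w(1)] \<open>0 \<le> \<delta>\<close> by (auto simp: dist_norm intro!: mult_left_mono)
      ultimately show "\<exists>z \<in> C \<inter> cball x r. norm (p - z) \<le> ?bound v"
        by force
    qed
    \<comment> \<open>As \<open>C \<subseteq> P\<close>, every point of \<open>C\<close> in the ball
      is its own partner, and any nonnegative bound suffices.\<close>
    have "0 \<le> ?bound v"
      using \<open>0 \<le> \<delta>\<close> \<open>0 \<le> \<epsilon>\<close> \<open>\<epsilon> \<le> r\<close> by simp
    then show "excess (C \<inter> cball x r) (P \<inter> cball x r) \<le> ereal (?bound v)"
      using P(5) by (intro excess_le) force
  qed
  \<comment> \<open>The witness must now generate the given \<open>p\<close>, so its hull part
    \<open>w\<close> replaces the farthest point, with \<open>t = 1\<close>. By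
    \<open>nearest\<close>, \<open>c\<close> is at least as close to \<open>p\<close> as the point
    \<open>z\<close> from \<open>point\<close>, and \<open>att\<close> turns this into a bound on
    the Hausdorff distance.\<close>
  moreover have "\<exists>v \<in> ?X. hausdorff_distance (P \<inter> cball x r) (C \<inter> cball x r) \<le> ereal (?bound v) \<and>
      (\<exists>d \<in> recession_cone P. \<exists>t \<ge> 0. p = v + t *\<^sub>R d)"
    if p: "p \<in> P \<inter> cball x r" and nearest: "\<forall>c' \<in> C \<inter> cball x r. norm (p - c) \<le> norm (p - c')"
      and att: "ereal (norm (p - c)) = hausdorff_distance (P \<inter> cball x r) (C \<inter> cball x r)" for p c
  proof -
    obtain w d where w: "w \<in> ?X" "d \<in> recession_cone P" "p = w + d"
      using line_free_polyhedron_decomposition[OF P(1,2)] p by blast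
    then obtain z where "z \<in> C \<inter> cball x r" "norm (p - z) \<le> ?bound w"
      using point p by blast
    then have "norm (p - c) \<le> ?bound w"
      using nearest by force
    then have "hausdorff_distance (P \<inter> cball x r) (C \<inter> cball x r) \<le> ereal (?bound w)"
      by (simp flip: att)
    moreover have "p = w + 1 *\<^sub>R d"
      using w(3) by simp
    ultimately show ?thesis
      using w(1,2) zero_le_one by blast
  qed
  ultimately show ?thesis
    using v(1) by blast
qed

end
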